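(* Let $r\ge 2$ and $k\ge 0$ be integers, let $a_{-k},\dots,a_k\in\mathbb{Z}_r$, let $F:\mathbb{Z}_r^{2k+1}\to\mathbb{Z}_r$ be the additive automaton rule $F(z_{-k},\dots,z_k)=\sum_{i=-k}^{k}a_i z_i\ (\mathrm{mod}\ r)$, and let $T_{F[-k,k]}:\Omega\to\Omega$, with $\Omega=\mathbb{Z}_r^{\mathbb{Z}}$, be the additive cellular automaton $(T_{F[-k,k]}x)_n=F(x_{n-k},\dots,x_{n+k})$, $n\in\mathbb{Z}$. Let $\mu$ be a probability measure on the product $\sigma$-algebra of $\Omega$ that is invariant under the shift $\sigma$ and under $T_{F[-k,k]}$. Then for every integer $u\ge 0$: (1) for the transformation $\Phi=\sigma T_{F[-k,k]}$, $$h_\mu(\Phi^{u})=u\,h_\mu(\Phi);$$ (2) if the rule $F$ is bipermutative, then for the action $\Phi$ generated by $\sigma$ and $T_{F[-k,k]}$, $$h_{\vec v}(\Phi^{u})=u\,h_{\vec v}(\Phi)\qquad\text{for all }\vec v\in\mathbb{Z}^2.$$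
   Context: $\mathbb{Z}_r=\{0,1,\dots,r-1\}$ denotes the integers modulo $r$; $\Omega=\mathbb{Z}_r^{\mathbb{Z}}$ is the space of doubly infinite sequences with the product topology and product $\sigma$-algebra. The shift is $(\sigma x)_n=x_{n+1}$; it commutes with $T=T_{F[-k,k]}$. For a measure-preserving transformation $S$, $h_\mu(S)$ denotes its measure-theoretic (Kolmogorov–Sinai) entropy, and $S^u$ its $u$-fold iterate ($S^0$ is the identity). Bipermutative: a rule $F:\mathbb{Z}_r^{m}\to\mathbb{Z}_r$ is right permutative if for all fixed values of its first $m-1$ arguments the map $x_m\mapsto F(\bar x_1,\dots,\bar x_{m-1},x_m)$ is a permutation of $\mathbb{Z}_r$; left permutative is defined in the same way with respect to the first argument (the others being fixed); $F$ is bipermutative if it is both right and left permutative. Natural extension: $\hat\Omega$ is the set of sequences $\hat x=(x^{(0)},x^{(1)},\dots)$ with $x^{(i)}\in\Omega$ and $Tx^{(i)}=x^{(i-1)}$ for $i\ge 1$, with the $\sigma$-algebra generated by the sets $E^{(m)}=\{\hat x\in\hat\Omega: x^{(m)}\in E\}$ ($m\ge0$, $E$ measurable in $\Omega$) and the probability measure $\hat\mu$ determined by $\hat\mu(E^{(m)})=\mu(E)$. The maps $\hat T\hat x=(Tx^{(0)},x^{(0)},x^{(1)},\dots)$ and $\hat\sigma\hat x=(\sigma x^{(0)},\sigma x^{(1)},\dots)$ are commuting invertible $\hat\mu$-preserving transformations of $\hat\Omega$. In part (2), $\Phi$ denotes the $\mathbb{Z}\times\mathbb{N}$-action $\Phi^{(p,q)}=\sigma^pT^q$,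 extended to the $\mathbb{Z}^2$-action $\Phi^{(p,q)}=\hat\sigma^{p}\hat T^{q}$ on the natural extension, and $\Phi^u$ denotes the action $(p,q)\mapsto\Phi^{(up,uq)}=\hat\sigma^{up}\hat T^{uq}$. For $\vec v=(p,q)\in\mathbb{Z}^2$ the directional entropies in the direction $\vec v$ are $$h_{\vec v}(\Phi)=h_{\hat\mu}(\hat\sigma^{p}\hat T^{q}),\qquad h_{\vec v}(\Phi^{u})=h_{\hat\mu}(\hat\sigma^{up}\hat T^{uq}).$$ *)

theory Defs
  imports "HOL-Probability.Probability"
begin

section \<open>Kolmogorov--Sinai entropy\<close>

definition finite_partition :: "'a measure \<Rightarrow> 'a set set \<Rightarrow> bool" where
  "finite_partition M P \<longleftrightarrow> finite P \<and> P \<subseteq> sets M \<and> disjoint P \<and> \<Union>P = space M"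

text \<open>Natural logarithm; the convention \<open>0 log 0 = 0\<close> is automatic. A partition may contain
  the empty set, which contributes nothing.\<close>

definition partition_entropy :: "'a measure \<Rightarrow> 'a set set \<Rightarrow> real" where
  "partition_entropy M P = - (\<Sum>A\<in>P. measure M A * ln (measure M A))"

definition partition_join :: "'a set set \<Rightarrow> 'a set set \<Rightarrow> 'a set set" where
  "partition_join P Q = {A \<inter> B | A B. A \<in> P \<and> B \<in> Q}"

definition partition_preimage :: "'a measure \<Rightarrow> ('a \<Rightarrow> 'a) \<Rightarrow> 'a set set \<Rightarrow> 'a set set" where
  "partition_preimage M S P = (\<lambda>A. S -` A \<inter> space M) ` P"

text \<open>\<open>iterated_join M S P n\<close> is the join of \<open>S\<^sup>-\<^sup>i P\<close> over \<open>i < n\<close>.\<close>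

primrec iterated_join :: "'a measure \<Rightarrow> ('a \<Rightarrow> 'a) \<Rightarrow> 'a set set \<Rightarrow> nat \<Rightarrow> 'a set set" where
  "iterated_join M S P 0 = {space M}"
| "iterated_join M S P (Suc n) =
     partition_join (iterated_join M S P n) (partition_preimage M (S ^^ n) P)"

definition entropy_wrt_partition :: "'a measure \<Rightarrow> ('a \<Rightarrow> 'a) \<Rightarrow> 'a set set \<Rightarrow> real" where
  "entropy_wrt_partition M S P =
     lim (\<lambda>n. partition_entropy M (iterated_join M S P n) / real n)"

definition ks_entropy :: "'a measure \<Rightarrow> ('a \<Rightarrow> 'a) \<Rightarrow> ereal" where
  "ks_entropy M S = (SUP P \<in> {P. finite_partition M P}. ereal (entropy_wrt_partition M S P))"

definition invariant_under :: "'a measure \<Rightarrow> ('a \<Rightarrow> 'a) \<Rightarrow> bool" where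
  "invariant_under M S \<longleftrightarrow> S \<in> measurable M M \<and> distr M M S = M"


section \<open>Cellular automata on doubly infinite sequences\<close>

text \<open>\<open>\<int>\<^sub>r\<close> is represented by \<open>{..<r}\<close>. The space of this measurable space is the set of all
  \<open>x :: int \<Rightarrow> nat\<close> with values in \<open>{..<r}\<close>.\<close>

definition seq_space :: "nat \<Rightarrow> (int \<Rightarrow> nat) measure" where
  "seq_space r = (\<Pi>\<^sub>M n\<in>(UNIV::int set). count_space {..<r})"

definition seq_shift :: "(int \<Rightarrow> nat) \<Rightarrow> (int \<Rightarrow> nat)" where
  "seq_shift x = (\<lambda>n. x (n + 1))"

text \<open>A rule \<open>\<int>\<^sub>r\<^bsup>2k+1\<^esup> \<rightarrow> \<int>\<^sub>r\<close> takes a tuple indexed by \<open>{- int k..int k}\<close>, represented as an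
  element of \<open>{- int k..int k} \<rightarrow>\<^sub>E {..<r}\<close>.\<close>

definition cellular_automaton ::
  "nat \<Rightarrow> ((int \<Rightarrow> nat) \<Rightarrow> nat) \<Rightarrow> (int \<Rightarrow> nat) \<Rightarrow> (int \<Rightarrow> nat)" where
  "cellular_automaton k F x = (\<lambda>n. F (\<lambda>i\<in>{- int k..int k}. x (n + i)))"

definition additive_rule :: "nat \<Rightarrow> nat \<Rightarrow> (int \<Rightarrow> nat) \<Rightarrow> (int \<Rightarrow> nat) \<Rightarrow> nat" where
  "additive_rule r k a z = (\<Sum>i\<in>{- int k..int k}. a i * z i) mod r"

definition right_permutative :: "nat \<Rightarrow> nat \<Rightarrow> ((int \<Rightarrow> nat) \<Rightarrow> nat) \<Rightarrow> bool" where
  "right_permutative r k F \<longleftrightarrow>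
     (\<forall>z \<in> {- int k..int k} \<rightarrow>\<^sub>E {..<r}. bij_betw (\<lambda>s. F (z(int k := s))) {..<r} {..<r})"

definition left_permutative :: "nat \<Rightarrow> nat \<Rightarrow> ((int \<Rightarrow> nat) \<Rightarrow> nat) \<Rightarrow> bool" where
  "left_permutative r k F \<longleftrightarrow>
     (\<forall>z \<in> {- int k..int k} \<rightarrow>\<^sub>E {..<r}. bij_betw (\<lambda>s. F (z(- int k := s))) {..<r} {..<r})"

definition bipermutative :: "nat \<Rightarrow> nat \<Rightarrow> ((int \<Rightarrow> nat) \<Rightarrow> nat) \<Rightarrow> bool" where
  "bipermutative r k F \<longleftrightarrow> right_permutative r k F \<and> left_permutative r k F"


section \<open>Natural extension\<close>

definition natext_space :: "'a measure \<Rightarrow> ('a \<Rightarrow> 'a) \<Rightarrow> (nat \<Rightarrow> 'a) set" where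
  "natext_space M T =
     {x. (\<forall>i. x i \<in> space M) \<and> (\<forall>i\<ge>1. T (x i) = x (i - 1))}"

definition natext_cylinder :: "'a measure \<Rightarrow> ('a \<Rightarrow> 'a) \<Rightarrow> nat \<times> 'a set \<Rightarrow> (nat \<Rightarrow> 'a) set" where
  "natext_cylinder M T = (\<lambda>(m, E). {x \<in> natext_space M T. x m \<in> E})"

text \<open>The measure on the \<open>\<sigma>\<close>-algebra generated by the cylinders \<open>E\<^bsup>(m)\<^esup>\<close> determined by giving
  \<open>E\<^bsup>(m)\<^esup>\<close> the measure of \<open>E\<close>. It is unique because the cylinders are closed under intersection;
  it exists for invariant probability measures on standard Borel spaces, in particular for those
  on sequence spaces (otherwise \<^const>\<open>extend_measure\<close> would give the null measure).\<close>

definition natext_measure :: "'a measure \<Rightarrow> ('a \<Rightarrow> 'a) \<Rightarrow> (nat \<Rightarrow> 'a) measure" where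
  "natext_measure M T =
     extend_measure (natext_space M T) (UNIV \<times> sets M) (natext_cylinder M T)
       (\<lambda>(m, E). emeasure M E)"

definition natext_map :: "('a \<Rightarrow> 'a) \<Rightarrow> (nat \<Rightarrow> 'a) \<Rightarrow> (nat \<Rightarrow> 'a)" where
  "natext_map T x = (\<lambda>i. case i of 0 \<Rightarrow> T (x 0) | Suc j \<Rightarrow> x j)"

definition natext_lift :: "('a \<Rightarrow> 'a) \<Rightarrow> (nat \<Rightarrow> 'a) \<Rightarrow> (nat \<Rightarrow> 'a)" where
  "natext_lift S x = (\<lambda>i. S (x i))"


section \<open>Actions of \<open>\<int>\<^sup>2\<close> and directional entropy\<close>

text \<open>Integer iterates of a bijection \<open>f\<close> of \<open>A\<close>; negative ones iterate the inverse on \<open>A\<close>.\<close>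

definition int_iterate :: "'a set \<Rightarrow> ('a \<Rightarrow> 'a) \<Rightarrow> int \<Rightarrow> 'a \<Rightarrow> 'a" where
  "int_iterate A f n = (if 0 \<le> n then f ^^ nat n else inv_into A f ^^ nat (- n))"

definition natext_action ::
  "'a measure \<Rightarrow> ('a \<Rightarrow> 'a) \<Rightarrow> ('a \<Rightarrow> 'a) \<Rightarrow> int \<times> int \<Rightarrow> (nat \<Rightarrow> 'a) \<Rightarrow> (nat \<Rightarrow> 'a)" where
  "natext_action M S T = (\<lambda>(p, q).
     int_iterate (natext_space M T) (natext_lift S) p \<circ>
     int_iterate (natext_space M T) (natext_map T) q)"

definition action_power :: "(int \<times> int \<Rightarrow> 'b \<Rightarrow> 'b) \<Rightarrow> nat \<Rightarrow> int \<times> int \<Rightarrow> 'b \<Rightarrow> 'b" where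
  "action_power \<Phi> u = (\<lambda>(p, q). \<Phi> (int u * p, int u * q))"

definition directional_entropy ::
  "'b measure \<Rightarrow> (int \<times> int \<Rightarrow> 'b \<Rightarrow> 'b) \<Rightarrow> int \<times> int \<Rightarrow> ereal" where
  "directional_entropy N \<Phi> v = ks_entropy N (\<Phi> v)"

end

theory Submission
  imports Defs
begin

text \<open>For a measure-preserving \<open>S\<close>, the join of \<open>S\<^sup>-\<^sup>i P\<close> over \<open>i < u n\<close> is the \<open>n\<close>-th join along
  \<open>S\<^sup>u\<close> of the partition \<open>Q\<close> obtained by joining \<open>S\<^sup>-\<^sup>i P\<close> over \<open>i < u\<close>. By Fekete's lemma
  \<open>h(S\<^sup>u, Q) = u h(S, P)\<close>, and \<open>h(S\<^sup>u, P) \<le> h(S\<^sup>u, Q)\<close> since \<open>Q\<close> refines \<open>P\<close>; hence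
  \<open>h(S\<^sup>u) = u h(S)\<close>. This applies to \<open>\<sigma>T\<close> on \<open>\<Omega>\<close> and, as the lifts of \<open>\<sigma>\<close> and \<open>T\<close> to the natural
  extension commute and are invertible and measure preserving, to each element of the
  \<open>\<int>\<^sup>2\<close>-action.\<close>

section \<open>Fekete's lemma for subadditive sequences\<close>

text \<open>The limit is the infimum \<open>L\<close> of the quotients, so the lower bound is
  immediate. For the upper bound, take \<open>m\<close> with \<open>a m / m\<close> close to
  \<open>L\<close> and divide \<open>n\<close> by \<open>m\<close>: the full blocks cost at most
  \<open>(n div m) * a m\<close>, the remainder a bounded amount.\<close>

lemma subadditive_quotient_convergent:
  fixes a :: "nat \<Rightarrow> real"
  assumes sub: "\<And>m n. a (m + n) \<le> a m + a n" and nonneg: "\<And>n. 0 \<le> a n"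
  shows "convergent (\<lambda>n. a n / real n)"
proof -
  define L where "L = (INF n\<in>{1..}. a n / real n)"
  have bdd: "bdd_below ((\<lambda>n. a n / real n) ` {1..})"
    by (rule bdd_belowI[of _ 0]) (auto simp: nonneg)
  \<comment> \<open>The case \<open>q = 0\<close> is left out because subadditivity does not force
    \<open>a 0\<close> to vanish; hence \<open>n\<close> is taken to be at least \<open>m\<close>
    below.\<close>
  have mult: "a (q * m) \<le> real q * a m" if "q \<ge> 1" for q m
    using that
  proof (induction q rule: nat_induct_at_least)
    case (Suc q)
    then show ?case
      using sub[of m "q * m"] by (simp add: algebra_simps)
  qed simp
  have "(\<lambda>n. a n / real n) \<longlonglongrightarrow> L"
  proof (rule order_tendstoI)
    fix y assume "y < L"
    moreover have "L \<le> a n / real n" if "n \<ge> 1" for n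
      unfolding L_def using that by (intro cINF_lower[OF bdd]) auto
    ultimately show "\<forall>\<^sub>F n in sequentially. y < a n / real n"
      by (intro eventually_sequentiallyI[of 1]) (meson less_le_trans)
  next
    fix y assume "L < y"
    then obtain m where m: "m \<ge> 1" "a m / real m < y"
      unfolding L_def by (subst (asm) cINF_less_iff[OF _ bdd]) auto
    \<comment> \<open>A single bound for \<open>a (n mod m)\<close> over all remainders, as the
      summands are nonnegative.\<close>
    define C where "C = (\<Sum>s<m. a s)"
    have "(\<lambda>n. C / real n) \<longlonglongrightarrow> 0"
      by (rule lim_const_over_n)
    then have "\<forall>\<^sub>F n in sequentially. C / real n < y - a m / real m"
      by (rule order_tendstoD) (use m in simp)
    then show "\<forall>\<^sub>F n in sequentially. a n / real n < y"
      using eventually_ge_at_top[of m]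
    proof eventually_elim
      case (elim n)
      then have n: "n div m \<ge> 1" "real n > 0"
        using m by (auto simp: Suc_le_eq div_greater_zero_iff)
      have "a n \<le> a (n div m * m) + a (n mod m)"
        using sub[of "n div m * m" "n mod m"] by simp
      also have "a (n mod m) \<le> C"
        unfolding C_def by (rule member_le_sum) (use m nonneg in auto)
      also have "a (n div m * m) \<le> real (n div m) * a m"
        by (rule mult) fact
      also have "real (n div m) * a m \<le> real n / real m * a m"
        using of_nat_div_le_of_nat[of n m, where 'a = real] nonneg by (intro mult_right_mono) auto
      finally have "a n / real n \<le> (real n / real m * a m + C) / real n"
        using n by (intro divide_right_mono) auto
      also have "\<dots> = a m / real m + C / real n"
        using n by (simp add: add_divide_distrib)
      finally show ?case
        using elim by simp
    qed
  qed
  then show ?thesis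
    by (rule convergentI)
qed

section \<open>Partitions\<close>

lemma partition_join_eq: "partition_join P Q = (\<lambda>(A, B). A \<inter> B) ` (P \<times> Q)"
  by (auto simp: partition_join_def)

lemma partition_join_assoc:
  "partition_join (partition_join P Q) R = partition_join P (partition_join Q R)"
  unfolding partition_join_def by (auto; metis Int_assoc)

lemma partition_join_commute: "partition_join P Q = partition_join Q P"
  unfolding partition_join_def by (auto; metis Int_commute)

lemma partition_join_left_commute:
  "partition_join P (partition_join Q R) = partition_join Q (partition_join P R)"
  by (metis partition_join_assoc partition_join_commute)

lemma partition_preimage_join:
  "partition_preimage M S (partition_join P Q) =
     partition_join (partition_preimage M S P) (partition_preimage M S Q)"
proof -
  have "S -` (A \<inter> B) \<inter> space M = (S -` A \<inter> space M) \<inter> (S -` B \<inter> space M)" for A B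
    by auto
  then show ?thesis
    by (simp add: partition_preimage_def partition_join_eq image_image split_def
        flip: image_paired_Times)
qed

lemma funpow_funcset: "S ^^ n \<in> A \<rightarrow> A" if "S \<in> A \<rightarrow> A"
  using that by (induction n) auto

lemma partition_preimage_funpow:
  assumes "S \<in> space M \<rightarrow> space M"
  shows "partition_preimage M (S ^^ m) (partition_preimage M (S ^^ n) P) =
    partition_preimage M (S ^^ (m + n)) P"
proof -
  have "(S ^^ m) -` ((S ^^ n) -` A \<inter> space M) \<inter> space M = (S ^^ (m + n)) -` A \<inter> space M" for A
    using funpow_funcset[OF assms, of m] by (auto simp: add.commute[of m n] funpow_add)
  then show ?thesis
    by (simp add: partition_preimage_def image_image)
qed

lemma partition_join_space: "partition_join P {space M} = P" if "\<Union>P \<subseteq> space M"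
proof -
  have "A \<inter> space M = A" if "A \<in> P" for A
    using \<open>\<Union>P \<subseteq> space M\<close> that by auto
  then show ?thesis
    by (force simp: partition_join_def)
qed

lemma partition_preimage_space:
  "partition_preimage M S {space M} = {space M}" if "S \<in> space M \<rightarrow> space M"
  using that by (auto simp: partition_preimage_def)

lemma partition_preimage_id: "partition_preimage M (\<lambda>x. x) P = P" if "\<Union>P \<subseteq> space M"
proof -
  have "A \<inter> space M = A" if "A \<in> P" for A
    using \<open>\<Union>P \<subseteq> space M\<close> that by auto
  then show ?thesis
    by (simp add: partition_preimage_def)
qed

section \<open>Iterated joins along a map\<close>

lemma iterated_join_one: "iterated_join M S P 1 = P" if "\<Union>P \<subseteq> space M"
  using that by (simp add: id_def partition_preimage_id partition_join_space
      partition_join_commute[of "{space M}"])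

lemma iterated_join_subset: "\<Union>(iterated_join M S P n) \<subseteq> space M"
  by (induction n) (auto simp: partition_join_def partition_preimage_def)

text \<open>The indices below \<open>m + n\<close> are split at \<open>m\<close>; those in the
  second group are \<open>m + j\<close> with \<open>j < n\<close>, whence the common preimage under
  \<open>S ^^ m\<close>. Subadditivity and the passage to powers of \<open>S\<close> both rest on
  this.\<close>

lemma iterated_join_add:
  assumes "S \<in> space M \<rightarrow> space M"
  shows "iterated_join M S P (m + n) =
    partition_join (iterated_join M S P m) (partition_preimage M (S ^^ m) (iterated_join M S P n))"
proof (induction n)
  case 0
  have "partition_preimage M (S ^^ m) {space M} = {space M}"
    by (intro partition_preimage_space funpow_funcset[OF assms])
  then show ?case
    by (simp add: partition_join_space iterated_join_subset)
next
  case (Suc n)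
  then show ?case
    by (simp add: partition_preimage_join partition_join_assoc partition_preimage_funpow[OF assms])
qed

text \<open>Makes refinement by \<open>Q\<close> visible at every stage \<open>n\<close>, so that
  entropies can be compared before the limit is taken.\<close>

lemma iterated_join_join:
  "iterated_join M S (partition_join P Q) n =
    partition_join (iterated_join M S P n) (iterated_join M S Q n)"
proof (induction n)
  case 0
  then show ?case by (simp add: partition_join_def)
next
  case (Suc n)
  then show ?case
    by (simp add: partition_preimage_join partition_join_assoc partition_join_left_commute)
qed

lemma iterated_join_funpow:
  assumes "S \<in> space M \<rightarrow> space M"
  shows "iterated_join M (S ^^ u) (iterated_join M S P u) n = iterated_join M S P (u * n)"
proof (induction n)
  case (Suc n)
  have "iterated_join M S P (u * Suc n) = iterated_join M S P (u * n + u)"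
    by (simp add: add.commute)
  then show ?case
    by (simp add: Suc iterated_join_add[OF assms] funpow_mult mult.commute)
qed simp

section \<open>Closure properties of finite partitions\<close>

lemma finite_partition_space: "finite_partition M {space M}"
  by (simp add: finite_partition_def)

lemma finite_partition_join:
  assumes "finite_partition M P" "finite_partition M Q"
  shows "finite_partition M (partition_join P Q)"
proof -
  have "disjoint (partition_join P Q)"
  proof (rule disjointI)
    fix X Y assume "X \<in> partition_join P Q" "Y \<in> partition_join P Q" "X \<noteq> Y"
    then obtain A B A' B' where "X = A \<inter> B" "Y = A' \<inter> B'" "A \<in> P" "A' \<in> P" "B \<in> Q" "B' \<in> Q"
      "A \<noteq> A' \<or> B \<noteq> B'"
      by (auto simp: partition_join_def)
    then show "X \<inter> Y = {}"
      using assms disjointD[of P A A'] disjointD[of Q B B'] by (auto simp: finite_partition_def)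
  qed
  moreover have "\<Union>(partition_join P Q) = \<Union>P \<inter> \<Union>Q"
    by (auto simp: partition_join_def)
  ultimately show ?thesis
    using assms by (auto simp: finite_partition_def partition_join_eq)
qed

lemma finite_partition_preimage:
  assumes "finite_partition M P" "S \<in> measurable M M"
  shows "finite_partition M (partition_preimage M S P)"
proof -
  have "disjoint (partition_preimage M S P)"
    using assms by (fastforce simp: finite_partition_def partition_preimage_def intro!: disjointI
        dest: disjointD)
  moreover have "\<Union>(partition_preimage M S P) = S -` \<Union>P \<inter> space M"
    by (auto simp: partition_preimage_def)
  moreover have "S -` space M \<inter> space M = space M"
    using measurable_space[OF assms(2)] by auto
  ultimately show ?thesis
    using assms by (auto simp: finite_partition_def partition_preimage_def intro: measurable_sets)
qed

section \<open>Entropy of finite partitions\<close>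

context prob_space
begin

lemma sum_partition:
  assumes "finite_partition M Q" "A \<in> sets M"
  shows "(\<Sum>B\<in>Q. prob (A \<inter> B)) = prob A"
proof -
  have "prob (\<Union>B\<in>Q. A \<inter> B) = (\<Sum>B\<in>Q. prob (A \<inter> B))"
  proof (rule finite_measure_finite_Union)
    show "disjoint_family_on ((\<inter>) A) Q"
      using assms by (auto simp: finite_partition_def disjoint_family_on_def disjoint_def)
  qed (use assms in \<open>auto simp: finite_partition_def\<close>)
  moreover have "(\<Union>B\<in>Q. A \<inter> B) = A"
    using assms sets.sets_into_space[of A M] by (auto simp: finite_partition_def)
  ultimately show ?thesis by simp
qed

text \<open>The join is a set, so coinciding intersections are counted once. Different pairs of
  cells have disjoint intersections, which coincide only when empty, and empty cells add zero to the
  double sum.\<close>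

lemma partition_entropy_join:
  assumes "finite_partition M P" "finite_partition M Q"
  shows "partition_entropy M (partition_join P Q) =
    - (\<Sum>A\<in>P. \<Sum>B\<in>Q. prob (A \<inter> B) * ln (prob (A \<inter> B)))"
proof -
  have fin: "finite (P \<times> Q)"
    using assms by (simp add: finite_partition_def)
  have "(\<Sum>X\<in>(\<lambda>(A, B). A \<inter> B) ` (P \<times> Q). prob X * ln (prob X)) =
      (\<Sum>(A, B)\<in>P \<times> Q. prob (A \<inter> B) * ln (prob (A \<inter> B)))"
  proof (subst sum.reindex_nontrivial[OF fin])
    fix x y
    assume xy: "x \<in> P \<times> Q" "y \<in> P \<times> Q" "x \<noteq> y"
      and eq: "(case x of (A, B) \<Rightarrow> A \<inter> B) = (case y of (A, B) \<Rightarrow> A \<inter> B)"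
    obtain A B A' B' where [simp]: "x = (A, B)" "y = (A', B')"
      by (cases x, cases y)
    have "(A \<inter> B) \<inter> (A' \<inter> B') = {}"
      using xy assms disjointD[of P A A'] disjointD[of Q B B'] by (auto simp: finite_partition_def)
    then have "A \<inter> B = {}"
      using eq by auto
    then show "prob (case x of (A, B) \<Rightarrow> A \<inter> B) * ln (prob (case x of (A, B) \<Rightarrow> A \<inter> B)) = 0"
      by simp
  qed (auto intro!: sum.cong)
  then show ?thesis
    by (simp add: partition_entropy_def partition_join_eq sum.cartesian_product)
qed

lemma partition_entropy_nonneg: "0 \<le> partition_entropy M P"
proof -
  have "prob A * ln (prob A) \<le> 0" for A
    by (cases "prob A = 0") (auto intro!: mult_nonneg_nonpos simp: ln_le_zero_iff zero_less_measure_iff)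
  then show ?thesis
    by (simp add: partition_entropy_def sum_nonpos)
qed

text \<open>Inside a cell \<open>A\<close> of positive measure, the logarithm of each non-null
  \<open>prob (A \<inter> B)\<close> is at most \<open>ln (prob A)\<close>; total probability
  evaluates the resulting sum over \<open>B\<close>.\<close>

lemma partition_entropy_le_join:
  assumes P: "finite_partition M P" and Q: "finite_partition M Q"
  shows "partition_entropy M P \<le> partition_entropy M (partition_join P Q)"
proof -
  have "(\<Sum>B\<in>Q. prob (A \<inter> B) * ln (prob (A \<inter> B))) \<le> prob A * ln (prob A)" if "A \<in> P" for A
  proof -
    have A: "A \<in> sets M"
      using P that by (auto simp: finite_partition_def)
    have "prob (A \<inter> B) * ln (prob (A \<inter> B)) \<le> prob (A \<inter> B) * ln (prob A)" for B
    proof (cases "prob (A \<inter> B) = 0")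
      case False
      then have "0 < prob (A \<inter> B)"
        by (simp add: zero_less_measure_iff)
      moreover have "prob (A \<inter> B) \<le> prob A"
        by (rule finite_measure_mono) (use A in auto)
      ultimately show ?thesis
        by (intro mult_left_mono) auto
    qed simp
    then have "(\<Sum>B\<in>Q. prob (A \<inter> B) * ln (prob (A \<inter> B))) \<le> (\<Sum>B\<in>Q. prob (A \<inter> B) * ln (prob A))"
      by (rule sum_mono)
    also have "\<dots> = prob A * ln (prob A)"
      using sum_partition[OF Q A] by (simp flip: sum_distrib_right)
    finally show ?thesis .
  qed
  then show ?thesis
    unfolding partition_entropy_join[OF P Q] by (auto simp: partition_entropy_def intro: sum_mono)
qed

text \<open>Mutual information is nonnegative. This is Gibbs' inequality, obtained from
  \<open>ln t \<le> t - 1\<close> with \<open>t\<close> the ratio of product to joint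
  probability.\<close>

lemma partition_entropy_join_le:
  assumes P: "finite_partition M P" and Q: "finite_partition M Q"
  shows "partition_entropy M (partition_join P Q) \<le> partition_entropy M P + partition_entropy M Q"
proof -
  have sets: "\<And>A. A \<in> P \<Longrightarrow> A \<in> sets M" "\<And>B. B \<in> Q \<Longrightarrow> B \<in> sets M"
    using P Q by (auto simp: finite_partition_def)
  \<comment> \<open>The summand of the mutual information. For a null intersection it is zero, while
    the lower bound claimed next is at most zero.\<close>
  let ?d = "\<lambda>A B. prob (A \<inter> B) * (ln (prob (A \<inter> B)) - ln (prob A) - ln (prob B))"
  have pointwise: "prob (A \<inter> B) - prob A * prob B \<le> ?d A B" if "A \<in> P" "B \<in> Q" for A B
  proof (cases "prob (A \<inter> B) = 0")
    case False
    then have pos: "0 < prob (A \<inter> B)"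
      by (simp add: zero_less_measure_iff)
    have "prob (A \<inter> B) \<le> prob A" "prob (A \<inter> B) \<le> prob B"
      by (rule finite_measure_mono; use sets that in auto)+
    with pos have pos': "0 < prob A" "0 < prob B"
      by linarith+
    have "ln (prob A * prob B / prob (A \<inter> B)) \<le> prob A * prob B / prob (A \<inter> B) - 1"
      using pos pos' by (intro ln_le_minus_one) simp
    then have "prob (A \<inter> B) * ln (prob A * prob B / prob (A \<inter> B))
        \<le> prob (A \<inter> B) * (prob A * prob B / prob (A \<inter> B) - 1)"
      using pos by (intro mult_left_mono) auto
    then show ?thesis
      using pos pos' by (simp add: ln_div ln_mult algebra_simps)
  qed simp
  have space: "(\<Sum>B\<in>R. prob B) = 1" if "finite_partition M R" for R
  proof -
    have "(\<Sum>B\<in>R. prob B) = (\<Sum>B\<in>R. prob (space M \<inter> B))"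
      using that by (intro sum.cong refl arg_cong[where f = prob])
        (auto simp: finite_partition_def)
    then show ?thesis
      using sum_partition[OF that sets.top] prob_space by simp
  qed
  \<comment> \<open>The lower bounds cancel in total: joint and product probabilities both sum to
    one.\<close>
  have "0 = (\<Sum>A\<in>P. \<Sum>B\<in>Q. prob (A \<inter> B) - prob A * prob B)"
    using sets by (simp add: sum_subtractf sum_partition[OF Q] space[OF P] space[OF Q]
        flip: sum_distrib_left)
  also have "\<dots> \<le> (\<Sum>A\<in>P. \<Sum>B\<in>Q. ?d A B)"
    by (intro sum_mono pointwise)
  also have "\<dots> = (\<Sum>A\<in>P. \<Sum>B\<in>Q. prob (A \<inter> B) * ln (prob (A \<inter> B)))
      - (\<Sum>A\<in>P. (\<Sum>B\<in>Q. prob (A \<inter> B)) * ln (prob A))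
      - (\<Sum>B\<in>Q. (\<Sum>A\<in>P. prob (B \<inter> A)) * ln (prob B))"
  proof -
    have "(\<Sum>B\<in>Q. (\<Sum>A\<in>P. prob (B \<inter> A)) * ln (prob B)) =
        (\<Sum>A\<in>P. \<Sum>B\<in>Q. prob (A \<inter> B) * ln (prob B))"
      by (subst sum.swap) (simp add: sum_distrib_right Int_commute)
    then show ?thesis
      by (simp add: right_diff_distrib sum_subtractf sum_distrib_right)
  qed
  also have "(\<Sum>A\<in>P. (\<Sum>B\<in>Q. prob (A \<inter> B)) * ln (prob A)) = - partition_entropy M P"
    using sets by (simp add: sum_partition[OF Q] partition_entropy_def)
  also have "(\<Sum>B\<in>Q. (\<Sum>A\<in>P. prob (B \<inter> A)) * ln (prob B)) = - partition_entropy M Q"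
    using sets by (simp add: sum_partition[OF P] partition_entropy_def)
  finally show ?thesis
    by (simp add: partition_entropy_join[OF P Q])
qed

end

section \<open>Entropy of iterates\<close>

lemma invariant_under_space: "S \<in> space M \<rightarrow> space M" if "invariant_under M S"
  using that by (auto simp: invariant_under_def dest: measurable_space)

lemma invariant_under_emeasure:
  assumes "invariant_under M S" "A \<in> sets M"
  shows "emeasure M (S -` A \<inter> space M) = emeasure M A"
  using assms emeasure_distr[of S M M A] by (simp add: invariant_under_def)

lemma invariant_under_id: "invariant_under M (\<lambda>x. x)"
  by (simp add: invariant_under_def distr_id)

lemma invariant_under_comp: "invariant_under M (f \<circ> g)" if "invariant_under M f" "invariant_under M g"
  using that by (auto simp: invariant_under_def simp flip: distr_distr)

lemma invariant_under_funpow: "invariant_under M (S ^^ n)" if "invariant_under M S"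
  using that by (induction n) (auto intro: invariant_under_comp simp: invariant_under_id id_def)

lemma finite_partition_iterated_join:
  "finite_partition M (iterated_join M S P n)" if "invariant_under M S" "finite_partition M P"
proof (induction n)
  case (Suc n)
  moreover have "S ^^ n \<in> measurable M M"
    using invariant_under_funpow[OF that(1)] by (simp add: invariant_under_def)
  ultimately show ?case
    using that by (auto intro!: finite_partition_join finite_partition_preimage)
qed (simp add: finite_partition_space)

text \<open>Invariance keeps the measure of every cell. Distinct cells with equal preimages are
  disjoint, so that preimage is empty and collapsing the cells costs nothing.\<close>

lemma partition_entropy_preimage:
  assumes S: "invariant_under M S" and P: "finite_partition M P"
  shows "partition_entropy M (partition_preimage M S P) = partition_entropy M P"
proof -
  have "(\<Sum>A\<in>(\<lambda>A. S -` A \<inter> space M) ` P. measure M A * ln (measure M A)) =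
      (\<Sum>A\<in>P. measure M (S -` A \<inter> space M) * ln (measure M (S -` A \<inter> space M)))"
  proof (subst sum.reindex_nontrivial)
    fix A B assume AB: "A \<in> P" "B \<in> P" "A \<noteq> B" "S -` A \<inter> space M = S -` B \<inter> space M"
    then have "A \<inter> B = {}"
      using P by (auto simp: finite_partition_def disjoint_def)
    then have "S -` A \<inter> space M = {}"
      using AB by auto
    then show "measure M (S -` A \<inter> space M) * ln (measure M (S -` A \<inter> space M)) = 0"
      by simp
  qed (use P in \<open>auto simp: finite_partition_def\<close>)
  also have "\<dots> = (\<Sum>A\<in>P. measure M A * ln (measure M A))"
    using P by (intro sum.cong refl)
      (auto simp: finite_partition_def measure_def invariant_under_emeasure[OF S] subset_iff)
  finally show ?thesis
    by (simp add: partition_entropy_def partition_preimage_def)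
qed

context prob_space
begin

text \<open>The value of \<open>lim\<close> is informative only under convergence. Fekete's lemma
  supplies it: the join over \<open>m + n\<close> indices splits into two blocks, and by invariance
  the preimage of a block has the entropy of the block.\<close>

lemma entropy_wrt_partition_LIMSEQ:
  assumes S: "invariant_under M S" and P: "finite_partition M P"
  shows "(\<lambda>n. partition_entropy M (iterated_join M S P n) / real n) \<longlonglongrightarrow> entropy_wrt_partition M S P"
proof -
  have "convergent (\<lambda>n. partition_entropy M (iterated_join M S P n) / real n)"
  proof (rule subadditive_quotient_convergent)
    fix m n
    have "partition_entropy M (iterated_join M S P (m + n)) \<le> partition_entropy M (iterated_join M S P m)
        + partition_entropy M (partition_preimage M (S ^^ m) (iterated_join M S P n))"
      unfolding iterated_join_add[OF invariant_under_space[OF S]]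
      using finite_partition_iterated_join[OF S P] invariant_under_funpow[OF S, of m]
      by (intro partition_entropy_join_le finite_partition_preimage) (auto simp: invariant_under_def)
    then show "partition_entropy M (iterated_join M S P (m + n)) \<le>
        partition_entropy M (iterated_join M S P m) + partition_entropy M (iterated_join M S P n)"
      by (simp add: partition_entropy_preimage invariant_under_funpow S
          finite_partition_iterated_join P)
  qed (rule partition_entropy_nonneg)
  then show ?thesis
    by (simp add: convergent_LIMSEQ_iff entropy_wrt_partition_def)
qed

lemma entropy_wrt_partition_le_join:
  assumes S: "invariant_under M S" and P: "finite_partition M P" and Q: "finite_partition M Q"
  shows "entropy_wrt_partition M S P \<le> entropy_wrt_partition M S (partition_join P Q)"
  by (rule LIMSEQ_le[OF entropy_wrt_partition_LIMSEQ[OF S P]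
        entropy_wrt_partition_LIMSEQ[OF S finite_partition_join[OF P Q]]])
     (auto intro!: divide_right_mono partition_entropy_le_join finite_partition_iterated_join S P Q
       simp: iterated_join_join)

text \<open>Both sides are limits of one sequence: the left by the block identity, the right as
  \<open>u\<close> times a subsequence of the quotients for \<open>S\<close>. Positivity of
  \<open>u\<close> makes the indices \<open>u * n\<close> strictly increasing.\<close>

lemma entropy_wrt_partition_funpow:
  assumes S: "invariant_under M S" and P: "finite_partition M P" and u: "u > 0"
  shows "entropy_wrt_partition M (S ^^ u) (iterated_join M S P u) = real u * entropy_wrt_partition M S P"
proof (rule LIMSEQ_unique)
  let ?H = "\<lambda>n. partition_entropy M (iterated_join M S P n)"
  show "(\<lambda>n. ?H (u * n) / real n) \<longlonglongrightarrow> entropy_wrt_partition M (S ^^ u) (iterated_join M S P u)"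
    using entropy_wrt_partition_LIMSEQ[OF invariant_under_funpow[OF S]
        finite_partition_iterated_join[OF S P], of u u]
    by (simp add: iterated_join_funpow[OF invariant_under_space[OF S]])
  have "strict_mono (\<lambda>n. u * n)"
    using u by (simp add: strict_mono_def)
  from LIMSEQ_subseq_LIMSEQ[OF entropy_wrt_partition_LIMSEQ[OF S P] this]
  have "(\<lambda>n. real u * (?H (u * n) / real (u * n))) \<longlonglongrightarrow> real u * entropy_wrt_partition M S P"
    by (intro tendsto_mult_left) (simp add: o_def)
  then show "(\<lambda>n. ?H (u * n) / real n) \<longlonglongrightarrow> real u * entropy_wrt_partition M S P"
    using u by simp
qed

section \<open>Exponent zero: the entropy of the identity\<close>

text \<open>Empty cells carry no entropy. The slack is needed because joining a partition with
  itself may add the empty set.\<close>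

lemma partition_entropy_cong_empty:
  assumes "insert {} P = insert {} Q" "finite P"
  shows "partition_entropy M P = partition_entropy M Q"
proof -
  have "finite Q"
    using assms by (metis finite_insert)
  have "P - {{}} = Q - {{}}"
    using assms by blast
  moreover have "partition_entropy M R = - (\<Sum>A\<in>R - {{}}. prob A * ln (prob A))" if "finite R" for R
    using that by (auto simp: partition_entropy_def intro!: sum.mono_neutral_right)
  ultimately show ?thesis
    using \<open>finite P\<close> \<open>finite Q\<close> by simp
qed

text \<open>Every join over at least one index equals \<open>P\<close> up to the empty cell, so a
  constant entropy is divided by \<open>n\<close>.\<close>

lemma ks_entropy_id: "ks_entropy M (\<lambda>x. x) = 0"
proof -
  have "entropy_wrt_partition M (\<lambda>x. x) P = 0" if P: "finite_partition M P" for P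
  proof -
    have id: "(\<lambda>x. x) ^^ n = (\<lambda>x. x)" for n
      by (induction n) auto
    have sub: "\<Union>P \<subseteq> space M"
      using P by (simp add: finite_partition_def)
    have join: "insert {} (partition_join Q P) = insert {} P" if "insert {} Q = insert {} P" for Q
    proof -
      have "A \<inter> B = {} \<or> A \<inter> B = B" if "A \<in> Q" "B \<in> P" for A B
      proof -
        have "A = {} \<or> A \<in> P"
          using that \<open>insert {} Q = insert {} P\<close> by blast
        then show ?thesis
          using P that disjointD[of P A B] by (cases "A = B") (auto simp: finite_partition_def)
      qed
      moreover have "B \<in> partition_join Q P" if "B \<in> P" "B \<noteq> {}" for B
      proof -
        have "B \<in> Q"
          using that \<open>insert {} Q = insert {} P\<close> by blast
        then show ?thesis
          using that by (auto simp: partition_join_def intro!: exI[of _ B])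
      qed
      ultimately show ?thesis
        unfolding partition_join_def by fastforce
    qed
    \<comment> \<open>The index is shifted by one because the join over no indices is
      \<open>{space M}\<close>.\<close>
    have "insert {} (iterated_join M (\<lambda>x. x) P (Suc n)) = insert {} P" for n
    proof (induction n)
      case 0
      show ?case
        using iterated_join_one[OF sub, of "\<lambda>x. x"] by simp
    next
      case (Suc n)
      then show ?case
        by (subst iterated_join.simps) (simp only: id partition_preimage_id[OF sub] join)
    qed
    then have "partition_entropy M (iterated_join M (\<lambda>x. x) P (Suc n)) = partition_entropy M P" for n
      using finite_partition_iterated_join[OF invariant_under_id P, of "Suc n"]
      by (intro partition_entropy_cong_empty) (auto simp: finite_partition_def)
    then have "(\<lambda>n. partition_entropy M P / real (Suc n)) \<longlonglongrightarrow> entropy_wrt_partition M (\<lambda>x. x) P"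
      using LIMSEQ_Suc[OF entropy_wrt_partition_LIMSEQ[OF invariant_under_id P]] by simp
    moreover have "(\<lambda>n. partition_entropy M P / real (Suc n)) \<longlonglongrightarrow> 0"
      by (rule LIMSEQ_Suc[OF lim_const_over_n])
    ultimately show ?thesis
      by (rule LIMSEQ_unique)
  qed
  then show ?thesis
    using finite_partition_space by (auto simp: ks_entropy_def zero_ereal_def intro!: SUP_eq_const)
qed

theorem ks_entropy_funpow:
  assumes S: "invariant_under M S"
  shows "ks_entropy M (S ^^ u) = ereal (real u) * ks_entropy M S"
proof (cases "u = 0")
  \<comment> \<open>Since \<open>0 * \<infinity> = 0\<close> in \<open>ereal\<close>, the right side
    vanishes even when the entropy of \<open>S\<close> is infinite.\<close>
  case True
  then show ?thesis
    using ks_entropy_id by (simp add: id_def flip: zero_ereal_def)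
next
  case False
  then have u: "u > 0" by simp
  \<comment> \<open>The factor may enter the supremum because the index set is nonempty: it contains
    \<open>{space M}\<close>.\<close>
  have "ereal (real u) * ks_entropy M S =
      (SUP P\<in>{P. finite_partition M P}. ereal (real u * entropy_wrt_partition M S P))"
    unfolding ks_entropy_def using finite_partition_space
    by (subst Sup_ereal_mult_left') auto
  also have "\<dots> = ks_entropy M (S ^^ u)"
    unfolding ks_entropy_def
  proof (rule antisym; rule SUP_mono)
    fix P assume "P \<in> {P. finite_partition M P}"
    then have P: "finite_partition M P" by simp
    show "\<exists>Q\<in>{Q. finite_partition M Q}. ereal (real u * entropy_wrt_partition M S P)
        \<le> ereal (entropy_wrt_partition M (S ^^ u) Q)"
      using entropy_wrt_partition_funpow[OF S P u] finite_partition_iterated_join[OF S P]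
      by (intro bexI[of _ "iterated_join M S P u"]) auto
    \<comment> \<open>Splitting off index zero exhibits the block as a join of \<open>P\<close> with
      another finite partition, so replacing \<open>P\<close> by it cannot lower the entropy along
      \<open>S ^^ u\<close>.\<close>
    have "iterated_join M S P u = partition_join P (partition_preimage M S (iterated_join M S P (u - 1)))"
    proof -
      have "iterated_join M S P 1 = P"
        using P by (intro iterated_join_one) (simp add: finite_partition_def)
      then show ?thesis
        using iterated_join_add[OF invariant_under_space[OF S], of P 1 "u - 1"] u by simp
    qed
    moreover have "finite_partition M (partition_preimage M S (iterated_join M S P (u - 1)))"
      using S by (intro finite_partition_preimage finite_partition_iterated_join P)
        (auto simp: invariant_under_def)
    ultimately have "entropy_wrt_partition M (S ^^ u) P \<le> real u * entropy_wrt_partition M S P"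
      using entropy_wrt_partition_le_join[OF invariant_under_funpow[OF S] P]
      by (simp flip: entropy_wrt_partition_funpow[OF S P u])
    then show "\<exists>Q\<in>{Q. finite_partition M Q}. ereal (entropy_wrt_partition M (S ^^ u) P)
        \<le> ereal (real u * entropy_wrt_partition M S Q)"
      using P by auto
  qed
  finally show ?thesis by simp
qed

end

text \<open>Partitions see only points of the space. Below, the power law of the action is available
  only on the natural extension, not for arbitrary sequences.\<close>

lemma ks_entropy_cong:
  assumes S: "S \<in> space M \<rightarrow> space M" and eq: "\<And>x. x \<in> space M \<Longrightarrow> S x = S' x"
  shows "ks_entropy M S = ks_entropy M S'"
proof -
  have "(S ^^ n) x = (S' ^^ n) x" if "x \<in> space M" for n x
  proof (induction n)
    case (Suc n)
    have "(S ^^ n) x \<in> space M"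
      using funpow_funcset[OF S, of n] that by auto
    then show ?case
      using Suc eq by simp
  qed simp
  then have "partition_preimage M (S ^^ n) P = partition_preimage M (S' ^^ n) P" for n P
    by (auto simp: partition_preimage_def intro!: image_cong)
  then have "iterated_join M S P n = iterated_join M S' P n" for n P
    by (induction n) auto
  then show ?thesis
    by (simp add: ks_entropy_def entropy_wrt_partition_def)
qed

lemma ks_entropy_null_measure: "ks_entropy M S = 0" if "\<And>A. measure M A = 0"
proof -
  have "entropy_wrt_partition M S P = 0" for P
    by (simp add: entropy_wrt_partition_def partition_entropy_def that)
  then show ?thesis
    using finite_partition_space by (auto simp: ks_entropy_def zero_ereal_def intro!: SUP_eq_const)
qed

section \<open>Inverses and integer iterates\<close>

lemma invariant_under_cong:
  assumes "invariant_under M f" "\<And>x. x \<in> space M \<Longrightarrow> f x = g x"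
  shows "invariant_under M g"
proof -
  have "g \<in> measurable M M"
    using assms by (simp add: invariant_under_def cong: measurable_cong)
  moreover have "distr M M g = distr M M f"
    using assms by (intro distr_cong) auto
  ultimately show ?thesis
    using assms by (simp add: invariant_under_def)
qed

text \<open>As \<open>M\<close> is its own image under \<open>f\<close>, its image under
  \<open>g\<close> is its image under \<open>g \<circ> f\<close>, the identity on the space.\<close>

lemma invariant_under_left_inverse:
  assumes f: "invariant_under M f" and g: "g \<in> measurable M M"
    and inv: "\<And>x. x \<in> space M \<Longrightarrow> g (f x) = x"
  shows "invariant_under M g"
proof -
  have "distr M M g = distr (distr M M f) M g"
    using f by (simp add: invariant_under_def)
  also have "\<dots> = distr M M (g \<circ> f)"
    using f g by (intro distr_distr) (auto simp: invariant_under_def)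
  also have "\<dots> = distr M M (\<lambda>x. x)"
    using inv by (intro distr_cong) auto
  finally show ?thesis
    using g by (simp add: invariant_under_def distr_id)
qed

lemma inv_into_funcset: "inv_into A f \<in> A \<rightarrow> A" if "bij_betw f A A"
  using bij_betw_inv_into[OF that] by (auto dest: bij_betwE)

lemma int_iterate_funcset: "int_iterate A f n \<in> A \<rightarrow> A" if "bij_betw f A A"
  using that inv_into_funcset[OF that]
  by (auto simp: int_iterate_def dest: bij_betwE intro!: funpow_funcset[THEN funcset_mem])

lemma int_iterate_mult: "int_iterate A f (int u * n) = int_iterate A f n ^^ u"
proof (cases "0 \<le> n")
  case True
  then show ?thesis
    by (simp add: int_iterate_def funpow_mult nat_mult_distrib mult.commute)
next
  case False
  then show ?thesis
  \<comment> \<open>For \<open>u = 0\<close> the product is zero and leaves the negative branch of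
    \<open>int_iterate\<close>.\<close>
  proof (cases "u = 0")
    case u: False
    then have "\<not> 0 \<le> int u * n"
      using False by (simp add: zero_le_mult_iff)
    moreover have "nat (- (int u * n)) = nat (- n) * u"
      using nat_mult_distrib[of "int u" "- n"] by (simp add: mult.commute)
    ultimately show ?thesis
      using False by (simp add: int_iterate_def funpow_mult)
  qed (simp add: int_iterate_def)
qed

section \<open>Commuting maps and their iterates\<close>

lemma funpow_commute_on:
  assumes "f \<in> A \<rightarrow> A" "\<And>x. x \<in> A \<Longrightarrow> f (g x) = g (f x)" "x \<in> A"
  shows "(f ^^ n) (g x) = g ((f ^^ n) x)"
  using assms funpow_funcset[OF assms(1)] by (induction n) auto

text \<open>Injectivity of \<open>f\<close> carries commutation with \<open>g\<close> over to the
  inverse of \<open>f\<close>, and induction carries both over to iterates.\<close>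

lemma int_iterate_commute:
  assumes f: "bij_betw f A A" and g: "g \<in> A \<rightarrow> A"
    and comm: "\<And>x. x \<in> A \<Longrightarrow> f (g x) = g (f x)" and x: "x \<in> A"
  shows "int_iterate A f n (g x) = g (int_iterate A f n x)"
proof -
  have "inv_into A f (g y) = g (inv_into A f y)" if "y \<in> A" for y
  proof (rule inv_into_f_eq)
    have y: "inv_into A f y \<in> A" "f (inv_into A f y) = y"
      using inv_into_funcset[OF f] f that by (auto simp: bij_betw_inv_into_right)
    then show "g (inv_into A f y) \<in> A" "f (g (inv_into A f y)) = g y"
      using g comm by auto
  qed (use f in \<open>simp add: bij_betw_def\<close>)
  then show ?thesis
    using funpow_commute_on[of f A g x] funpow_commute_on[of "inv_into A f" A g x] f comm x
      inv_into_funcset[OF f] by (auto simp: int_iterate_def dest: bij_betwE)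
qed

lemma funpow_comp_commute_on:
  assumes "f \<in> A \<rightarrow> A" "g \<in> A \<rightarrow> A" "\<And>x. x \<in> A \<Longrightarrow> f (g x) = g (f x)" "x \<in> A"
  shows "((f \<circ> g) ^^ n) x = (f ^^ n) ((g ^^ n) x)"
proof (induction n)
  case (Suc n)
  have gn: "(g ^^ n) x \<in> A"
    using funpow_funcset[OF assms(2)] assms(4) by auto
  have "((f \<circ> g) ^^ Suc n) x = f (g ((f ^^ n) ((g ^^ n) x)))"
    by (simp add: Suc)
  also have "g ((f ^^ n) ((g ^^ n) x)) = (f ^^ n) (g ((g ^^ n) x))"
    using funpow_commute_on[where f = f and g = g, OF assms(1,3) gn] by simp
  finally show ?case by simp
qed simp

text \<open>Measurability of \<open>inv_into\<close> is not evident from its definition by choice;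
  on the space it agrees with the measure-preserving inverse \<open>g\<close>.\<close>

lemma invariant_under_int_iterate:
  assumes f: "invariant_under M f" and g: "invariant_under M g"
    and inv: "\<And>x. x \<in> space M \<Longrightarrow> f (g x) = x" "\<And>x. x \<in> space M \<Longrightarrow> g (f x) = x"
  shows "invariant_under M (int_iterate (space M) f n)"
proof -
  have "inj_on f (space M)"
    by (rule inj_on_inverseI) (rule inv)
  then have "invariant_under M (inv_into (space M) f)"
    using invariant_under_space[OF g] inv
    by (intro invariant_under_cong[OF g]) (auto intro!: inv_into_f_eq[symmetric])
  then show ?thesis
    using f by (auto simp: int_iterate_def intro: invariant_under_funpow)
qed

text \<open>The generators commute on the natural extension, hence so do their integer iterates, and
  a power of a composition of these distributes over the two factors.\<close>

lemma action_power_natext_action: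
  assumes S: "bij_betw (natext_lift S) (natext_space M T) (natext_space M T)"
    and T: "bij_betw (natext_map T) (natext_space M T) (natext_space M T)"
    and comm: "\<And>x. x \<in> natext_space M T \<Longrightarrow> natext_lift S (natext_map T x) = natext_map T (natext_lift S x)"
    and x: "x \<in> natext_space M T"
  shows "action_power (natext_action M S T) u v x = (natext_action M S T v ^^ u) x"
proof -
  let ?A = "natext_space M T"
  obtain p q where v: "v = (p, q)"
    by (cases v)
  let ?F = "int_iterate ?A (natext_lift S) p" and ?G = "int_iterate ?A (natext_map T) q"
  note funcset = int_iterate_funcset[OF S] int_iterate_funcset[OF T]
  \<comment> \<open>Commutation is extended in two rounds: first to iterates of the lift of
    \<open>S\<close>, then to iterates of \<open>natext_map T\<close>.\<close>
  have 1: "natext_map T (?F y) = ?F (natext_map T y)" if "y \<in> ?A" for y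
    using T comm that by (intro int_iterate_commute[symmetric] S) (auto dest: bij_betwE)
  have "?G (?F y) = ?F (?G y)" if "y \<in> ?A" for y
    using 1 that by (intro int_iterate_commute T funcset)
  then have "((?F \<circ> ?G) ^^ u) x = (?F ^^ u) ((?G ^^ u) x)"
    using funcset x by (intro funpow_comp_commute_on[of _ ?A]) auto
  then show ?thesis
    by (simp add: action_power_def natext_action_def v int_iterate_mult)
qed

section \<open>Invariance on the natural extension\<close>

lemma natext_space_Suc:
  "x \<in> natext_space M T \<longleftrightarrow> (\<forall>i. x i \<in> space M) \<and> (\<forall>i. T (x (Suc i)) = x i)"
proof -
  have "(\<forall>i\<ge>1. T (x i) = x (i - 1)) \<longleftrightarrow> (\<forall>i. T (x (Suc i)) = x i)"
    by (metis One_nat_def Suc_le_mono diff_Suc_1 le0 not0_implies_Suc not_one_le_zero)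
  then show ?thesis
    by (simp add: natext_space_def)
qed

lemma natext_cylinder_subset: "natext_cylinder M T ` I \<subseteq> Pow (natext_space M T)"
  by (auto simp: natext_cylinder_def)

lemma space_natext_measure [simp]: "space (natext_measure M T) = natext_space M T"
  by (simp add: natext_measure_def space_extend_measure natext_cylinder_subset)

lemma sets_natext_measure:
  "sets (natext_measure M T) = sigma_sets (natext_space M T) (natext_cylinder M T ` (UNIV \<times> sets M))"
  by (simp add: natext_measure_def sets_extend_measure natext_cylinder_subset)

lemma natext_cylinder_in_sets: "E \<in> sets M \<Longrightarrow> natext_cylinder M T (m, E) \<in> sets (natext_measure M T)"
  by (auto simp: sets_natext_measure)

text \<open>In the null case \<^const>\<open>extend_measure\<close> returns its junk value, for which all entropies vanish.\<close>

lemma natext_measure_cases: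
  obtains (null) "\<And>A. measure (natext_measure M T) A = 0"
  | (extends) "\<And>m E. E \<in> sets M \<Longrightarrow> emeasure (natext_measure M T) (natext_cylinder M T (m, E)) = emeasure M E"
\<comment> \<open>This is the existence clause in the definition of \<open>extend_measure\<close>;
  if it fails, the measure is zero by that definition.\<close>
proof (cases "\<exists>\<nu>. (\<forall>i\<in>UNIV \<times> sets M. \<nu> (natext_cylinder M T i) = (\<lambda>(m, E). emeasure M E) i) \<and>
    measure_space (natext_space M T) (sigma_sets (natext_space M T) (natext_cylinder M T ` (UNIV \<times> sets M))) \<nu>")
  case True
  then obtain \<nu> where
    \<nu>: "\<And>i. i \<in> UNIV \<times> sets M \<Longrightarrow> \<nu> (natext_cylinder M T i) = (\<lambda>(m, E). emeasure M E) i"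
      "positive (sets (natext_measure M T)) \<nu>" "countably_additive (sets (natext_measure M T)) \<nu>"
    by (auto simp: measure_space_def sets_natext_measure)
  have "emeasure (natext_measure M T) (natext_cylinder M T (m, E)) = emeasure M E" if "E \<in> sets M" for m E
    using emeasure_extend_measure[OF natext_measure_def \<nu>(1) natext_cylinder_subset \<nu>(2,3), of "(m, E)"] that
    by simp
  then show ?thesis
    by (rule extends)
next
  case False
  then have "natext_measure M T = sigma (natext_space M T) (natext_cylinder M T ` (UNIV \<times> sets M))"
    unfolding natext_measure_def extend_measure_def by (subst if_not_P) auto
  then have "measure (natext_measure M T) A = 0" for A
    by (simp add: measure_def emeasure_sigma)
  then show ?thesis
    by (rule null)
qed

lemma natext_space_funpow: "(T ^^ j) (x (i + j)) = x i" if "x \<in> natext_space M T"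
proof (induction j arbitrary: i)
  case (Suc j)
  have "T (x (Suc (i + j))) = x (i + j)"
    using that by (simp add: natext_space_Suc)
  then show ?case
    using Suc[of i] by (simp add: funpow_Suc_right del: funpow.simps)
qed simp

text \<open>Coordinate \<open>n\<close> determines coordinate \<open>m \<le> n\<close> through
  \<open>T ^^ (n - m)\<close>. Pulling the condition at level \<open>m\<close> back to level
  \<open>n\<close> leaves a single cylinder.\<close>

lemma Int_stable_natext_cylinder:
  assumes "T \<in> measurable M M"
  shows "Int_stable (natext_cylinder M T ` (UNIV \<times> sets M))"
proof (rule Int_stableI)
  have *: "natext_cylinder M T (m, E) \<inter> natext_cylinder M T (n, F) \<in> natext_cylinder M T ` (UNIV \<times> sets M)"
    if "m \<le> n" "E \<in> sets M" "F \<in> sets M" for m n E F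
  proof (rule image_eqI)
    let ?G = "((T ^^ (n - m)) -` E \<inter> space M) \<inter> F"
    have "(T ^^ (n - m)) (x n) = x m" if "x \<in> natext_space M T" for x
      using natext_space_funpow[OF that, of "n - m" m] \<open>m \<le> n\<close> by simp
    then show "natext_cylinder M T (m, E) \<inter> natext_cylinder M T (n, F) = natext_cylinder M T (n, ?G)"
      by (auto simp: natext_cylinder_def natext_space_Suc)
    have "T ^^ (n - m) \<in> measurable M M"
      using assms by (rule measurable_compose_n)
    then show "(n, ?G) \<in> UNIV \<times> sets M"
      using that by (auto intro: measurable_sets)
  qed
  fix X Y
  assume "X \<in> natext_cylinder M T ` (UNIV \<times> sets M)" "Y \<in> natext_cylinder M T ` (UNIV \<times> sets M)"
  then show "X \<inter> Y \<in> natext_cylinder M T ` (UNIV \<times> sets M)"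
    by (elim imageE SigmaE) (metis * Int_commute nle_le)
qed

section \<open>Maps of the natural extension\<close>

lemma natext_map_natext_space: "natext_map T \<in> natext_space M T \<rightarrow> natext_space M T"
  if "T \<in> space M \<rightarrow> space M"
proof
  fix x assume x: "x \<in> natext_space M T"
  have "natext_map T x i \<in> space M" for i
    using that x by (cases i) (auto simp: natext_space_Suc natext_map_def)
  moreover have "T (natext_map T x (Suc i)) = natext_map T x i" for i
    using x by (cases i) (auto simp: natext_space_Suc natext_map_def)
  ultimately show "natext_map T x \<in> natext_space M T"
    by (simp add: natext_space_Suc)
qed

text \<open>Forgetting coordinate 0 will serve as the inverse of \<open>natext_map T\<close>,
  although \<open>T\<close> itself may fail to be injective.\<close>

lemma natext_drop_natext_space: "(\<lambda>x i. x (Suc i)) \<in> natext_space M T \<rightarrow> natext_space M T"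
  by (auto simp: natext_space_Suc)

lemma natext_map_drop: "natext_map T (\<lambda>i. x (Suc i)) = x" if "x \<in> natext_space M T"
  using that by (auto simp: natext_space_Suc natext_map_def fun_eq_iff split: nat.split)

lemma natext_drop_map: "(\<lambda>i. natext_map T x (Suc i)) = x"
  by (simp add: natext_map_def)

lemma natext_lift_natext_space: "natext_lift S \<in> natext_space M T \<rightarrow> natext_space M T"
  if "S \<in> space M \<rightarrow> space M" "\<And>x. x \<in> space M \<Longrightarrow> S (T x) = T (S x)"
proof
  fix x assume x: "x \<in> natext_space M T"
  then have "T (S (x (Suc i))) = S (x i)" for i
    using \<open>\<And>x. x \<in> space M \<Longrightarrow> S (T x) = T (S x)\<close>[of "x (Suc i)"] by (simp add: natext_space_Suc)
  then show "natext_lift S x \<in> natext_space M T"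
    using x \<open>S \<in> space M \<rightarrow> space M\<close> by (auto simp: natext_space_Suc natext_lift_def)
qed

text \<open>The case in which cylinders have their prescribed measures; the null case is treated
  separately.\<close>

locale natext_prob = prob_space M for M :: "'a measure" +
  fixes T :: "'a \<Rightarrow> 'a"
  assumes T: "invariant_under M T"
    and extends: "E \<in> sets M \<Longrightarrow> emeasure (natext_measure M T) (natext_cylinder M T (m, E)) = emeasure M E"
begin

abbreviation "N \<equiv> natext_measure M T"

lemma emeasure_space_N: "emeasure N (natext_space M T) = 1"
proof -
  have "natext_cylinder M T (0, space M) = natext_space M T"
    by (auto simp: natext_cylinder_def natext_space_Suc)
  then show ?thesis
    using extends[of "space M" 0] emeasure_space_1 by simp
qed

lemma prob_space_N: "prob_space N"
  by (rule prob_spaceI) (simp add: emeasure_space_N)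

text \<open>Finite measures that agree on the intersection-stable cylinders are equal, so it
  suffices to pull each cylinder back to a cylinder whose base has the same measure.\<close>

lemma invariant_under_N:
  assumes f: "f \<in> natext_space M T \<rightarrow> natext_space M T"
    and cyl: "\<And>m E. E \<in> sets M \<Longrightarrow> \<exists>n F. F \<in> sets M \<and> emeasure M F = emeasure M E \<and>
      {x \<in> natext_space M T. f x m \<in> E} = natext_cylinder M T (n, F)"
  shows "invariant_under N f"
proof -
  let ?E = "natext_cylinder M T ` (UNIV \<times> sets M)"
  have cyl': "\<exists>n F. F \<in> sets M \<and> emeasure M F = emeasure M E \<and>
      f -` natext_cylinder M T (m, E) \<inter> natext_space M T = natext_cylinder M T (n, F)"
    if "E \<in> sets M" for m E
  proof -
    have "f -` natext_cylinder M T (m, E) \<inter> natext_space M T = {x \<in> natext_space M T. f x m \<in> E}"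
      using f by (auto simp: natext_cylinder_def)
    then show ?thesis
      using cyl[OF that, of m] by simp
  qed
  have meas: "f \<in> measurable N N"
  proof (rule measurable_sigma_sets[OF sets_natext_measure natext_cylinder_subset])
    show "f -` Y \<inter> space N \<in> sets N" if "Y \<in> ?E" for Y
    proof -
      obtain m E where Y: "Y = natext_cylinder M T (m, E)" "E \<in> sets M"
        using \<open>Y \<in> ?E\<close> by auto
      show ?thesis
        using cyl'[OF Y(2), of m] natext_cylinder_in_sets by (auto simp: Y(1))
    qed
  qed (use f in simp)
  have "distr N N f = N"
  proof (rule measure_eqI_generator_eq)
    show "Int_stable ?E"
      using T by (intro Int_stable_natext_cylinder) (simp add: invariant_under_def)
    show "?E \<subseteq> Pow (natext_space M T)"
      by (rule natext_cylinder_subset)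
    show "sets (distr N N f) = sigma_sets (natext_space M T) ?E" "sets N = sigma_sets (natext_space M T) ?E"
      by (simp_all add: sets_natext_measure)
    show "emeasure (distr N N f) X = emeasure N X" if "X \<in> ?E" for X
    proof -
      obtain m E where X: "X = natext_cylinder M T (m, E)" "E \<in> sets M"
        using \<open>X \<in> ?E\<close> by auto
      obtain n F where "F \<in> sets M" "emeasure M F = emeasure M E"
        "f -` natext_cylinder M T (m, E) \<inter> natext_space M T = natext_cylinder M T (n, F)"
        using cyl'[OF X(2), of m] by auto
      then show ?thesis
        using X by (simp add: emeasure_distr[OF meas] natext_cylinder_in_sets extends)
    qed
    \<comment> \<open>The whole space is itself a cylinder, so a constant sequence gives the
      required cover by generators of finite measure.\<close>
    have "natext_cylinder M T (0, space M) = natext_space M T"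
      by (auto simp: natext_cylinder_def natext_space_Suc)
    then show "range (\<lambda>_::nat. natext_space M T) \<subseteq> ?E"
      by (auto intro!: image_eqI[of _ _ "(0, space M)"])
    have "emeasure (distr N N f) (natext_space M T) = emeasure N (f -` natext_space M T \<inter> space N)"
      using sets.top[of N] by (intro emeasure_distr meas) simp
    also have "\<dots> \<le> emeasure N (space N)"
      by (rule emeasure_space)
    finally show "emeasure (distr N N f) (natext_space M T) \<noteq> \<infinity>"
      by (auto simp: emeasure_space_N top_unique)
  qed auto
  with meas show ?thesis
    by (simp add: invariant_under_def)
qed

text \<open>At level 0 the base is replaced by its preimage under \<open>T\<close>, of equal measure
  by invariance; a cylinder at level \<open>Suc j\<close> moves down to level
  \<open>j\<close>.\<close>

lemma invariant_under_natext_map: "invariant_under N (natext_map T)"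
proof (rule invariant_under_N)
  show "natext_map T \<in> natext_space M T \<rightarrow> natext_space M T"
    by (rule natext_map_natext_space[OF invariant_under_space[OF T]])
  fix m E assume E: "E \<in> sets M"
  show "\<exists>n F. F \<in> sets M \<and> emeasure M F = emeasure M E \<and>
      {x \<in> natext_space M T. natext_map T x m \<in> E} = natext_cylinder M T (n, F)"
  proof (cases m)
    case 0
    have "T -` E \<inter> space M \<in> sets M"
      using T E by (auto simp: invariant_under_def)
    moreover have "{x \<in> natext_space M T. natext_map T x m \<in> E} =
        natext_cylinder M T (0, T -` E \<inter> space M)"
      by (auto simp: natext_cylinder_def 0 natext_map_def natext_space_Suc)
    ultimately show ?thesis
      using invariant_under_emeasure[OF T E] by blast
  next
    case (Suc j)
    have "{x \<in> natext_space M T. natext_map T x m \<in> E} = natext_cylinder M T (j, E)"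
      by (simp add: natext_cylinder_def Suc natext_map_def)
    then show ?thesis
      using E by blast
  qed
qed

lemma invariant_under_natext_drop: "invariant_under N (\<lambda>x i. x (Suc i))"
proof (rule invariant_under_N)
  show "(\<lambda>x i. x (Suc i)) \<in> natext_space M T \<rightarrow> natext_space M T"
    by (rule natext_drop_natext_space)
  show "\<exists>n F. F \<in> sets M \<and> emeasure M F = emeasure M E \<and>
      {x \<in> natext_space M T. x (Suc m) \<in> E} = natext_cylinder M T (n, F)" if "E \<in> sets M" for m E
    using that by (intro exI[of _ "Suc m"] exI[of _ E]) (simp add: natext_cylinder_def)
qed

lemma invariant_under_natext_lift:
  assumes S: "invariant_under M S" and comm: "\<And>x. x \<in> space M \<Longrightarrow> S (T x) = T (S x)"
  shows "invariant_under N (natext_lift S)"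
proof (rule invariant_under_N)
  show "natext_lift S \<in> natext_space M T \<rightarrow> natext_space M T"
    by (rule natext_lift_natext_space[where S = S and T = T, OF invariant_under_space[OF S] comm])
  fix m E assume E: "E \<in> sets M"
  have "{x \<in> natext_space M T. natext_lift S x m \<in> E} = natext_cylinder M T (m, S -` E \<inter> space M)"
    by (auto simp: natext_cylinder_def natext_lift_def natext_space_Suc)
  moreover have "S -` E \<inter> space M \<in> sets M"
    using S E by (auto simp: invariant_under_def)
  ultimately show "\<exists>n F. F \<in> sets M \<and> emeasure M F = emeasure M E \<and>
      {x \<in> natext_space M T. natext_lift S x m \<in> E} = natext_cylinder M T (n, F)"
    using invariant_under_emeasure[OF S E] by blast
qed

end

section \<open>Directional entropy\<close>

text \<open>Each element of the action preserves the extended measure, so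
  \<open>ks_entropy_funpow\<close> applies to it; in the null case both sides are zero. The inverse
  \<open>R\<close> of \<open>S\<close> makes the lift of \<open>S\<close> invertible.\<close>

theorem directional_entropy_action_power:
  assumes M: "prob_space M" and T: "invariant_under M T"
    and S: "invariant_under M S" and R: "invariant_under M R"
    and inv: "\<And>x. x \<in> space M \<Longrightarrow> S (R x) = x" "\<And>x. x \<in> space M \<Longrightarrow> R (S x) = x"
    and comm: "\<And>x. x \<in> space M \<Longrightarrow> S (T x) = T (S x)"
  shows "directional_entropy (natext_measure M T) (action_power (natext_action M S T) u) v =
    ereal (real u) * directional_entropy (natext_measure M T) (natext_action M S T) v"
proof (cases rule: natext_measure_cases[of M T])
  case null
  then show ?thesis
    by (simp add: directional_entropy_def ks_entropy_null_measure)
next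
  case extends
  interpret prob_space M by (rule M)
  interpret natext_prob M T
    by standard (rule T, rule extends)
  interpret N: prob_space N by (rule prob_space_N)
  note S_space = invariant_under_space[OF S] and R_space = invariant_under_space[OF R]
    and T_space = invariant_under_space[OF T]
  \<comment> \<open>Commutation with \<open>R\<close> follows from that with \<open>S\<close> by
    writing \<open>x\<close> as \<open>S (R x)\<close>.\<close>
  have comm': "R (T x) = T (R x)" if "x \<in> space M" for x
  proof -
    have "R (T x) = R (T (S (R x)))"
      using that by (simp add: inv)
    also have "\<dots> = R (S (T (R x)))"
      using that R_space by (subst comm) auto
    also have "\<dots> = T (R x)"
      using that R_space T_space by (intro inv) auto
    finally show ?thesis .
  qed
  let ?A = "natext_space M T"
  have lift_inv: "natext_lift S (natext_lift R x) = x" "natext_lift R (natext_lift S x) = x" if "x \<in> ?A" for x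
    using that inv by (auto simp: natext_lift_def natext_space_Suc)
  have bij_S: "bij_betw (natext_lift S) ?A ?A"
    using natext_lift_natext_space[where S = S and T = T, OF S_space comm]
      natext_lift_natext_space[where S = R and T = T, OF R_space comm'] lift_inv
    by (intro bij_betw_byWitness[of _ "natext_lift R"]) auto
  have bij_T: "bij_betw (natext_map T) ?A ?A"
    using natext_map_natext_space[OF T_space] natext_drop_natext_space[of M T]
    by (intro bij_betw_byWitness[of _ "\<lambda>x i. x (Suc i)"]) (auto simp: natext_map_drop natext_drop_map)
  have comm_N: "natext_lift S (natext_map T x) = natext_map T (natext_lift S x)" if "x \<in> ?A" for x
    using that comm by (auto simp: natext_lift_def natext_map_def natext_space_Suc fun_eq_iff split: nat.split)
  have inv_N: "invariant_under N (natext_action M S T v)"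
  proof -
    have "invariant_under N (int_iterate (space N) (natext_lift S) p)" for p
      using lift_inv by (intro invariant_under_int_iterate[of _ _ "natext_lift R"]
          invariant_under_natext_lift S R comm comm') auto
    moreover have "invariant_under N (int_iterate (space N) (natext_map T) q)" for q
      by (intro invariant_under_int_iterate[of _ _ "\<lambda>x i. x (Suc i)"]
          invariant_under_natext_map invariant_under_natext_drop)
        (auto simp: natext_map_drop natext_drop_map)
    ultimately show ?thesis
      by (auto simp: natext_action_def intro: invariant_under_comp split: prod.split)
  qed
  have "ks_entropy N (action_power (natext_action M S T) u v) = ks_entropy N (natext_action M S T v ^^ u)"
    using invariant_under_space[OF invariant_under_funpow[OF inv_N]]
    by (intro ks_entropy_cong[symmetric])
      (simp_all add: action_power_natext_action[OF bij_S bij_T comm_N])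
  then show ?thesis
    by (simp add: directional_entropy_def N.ks_entropy_funpow[OF inv_N])
qed

section \<open>The shift and cellular automata\<close>

text \<open>The same local rule is applied at every site, so translation passes through it.\<close>

lemma seq_shift_cellular_automaton:
  "seq_shift (cellular_automaton k F x) = cellular_automaton k F (seq_shift x)"
  by (simp add: seq_shift_def cellular_automaton_def algebra_simps cong: restrict_cong)

lemma measurable_seq_reindex: "(\<lambda>x n. x (f n)) \<in> measurable (seq_space r) (seq_space r)"
  unfolding seq_space_def by (rule measurable_PiM_single') (auto simp: space_PiM PiE_iff)

theorem theorem3p4:
  fixes r k u :: nat
    and a :: "int \<Rightarrow> nat"
    and F :: "(int \<Rightarrow> nat) \<Rightarrow> nat"
    and T :: "(int \<Rightarrow> nat) \<Rightarrow> (int \<Rightarrow> nat)"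
    and \<mu> :: "(int \<Rightarrow> nat) measure"
  assumes "2 \<le> r"
    and "\<forall>i\<in>{- int k..int k}. a i < r"
    and "F = additive_rule r k a"
    and "T = cellular_automaton k F"
    and "prob_space \<mu>"
    and "sets \<mu> = sets (seq_space r)"
    and "invariant_under \<mu> seq_shift"
    and "invariant_under \<mu> T"
  shows "ks_entropy \<mu> ((seq_shift \<circ> T) ^^ u) = ereal (real u) * ks_entropy \<mu> (seq_shift \<circ> T) \<and>
    (bipermutative r k F \<longrightarrow>
      (\<forall>v :: int \<times> int.
         directional_entropy (natext_measure \<mu> T) (action_power (natext_action \<mu> seq_shift T) u) v =
         ereal (real u) *
           directional_entropy (natext_measure \<mu> T) (natext_action \<mu> seq_shift T) v))"
proof (intro conjI impI allI)
  show "ks_entropy \<mu> ((seq_shift \<circ> T) ^^ u) = ereal (real u) * ks_entropy \<mu> (seq_shift \<circ> T)"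
    using assms by (intro prob_space.ks_entropy_funpow invariant_under_comp)
  fix v :: "int \<times> int"
  \<comment> \<open>The inverse shift; it preserves the measure because it undoes
    \<open>seq_shift\<close>.\<close>
  let ?R = "\<lambda>(x :: int \<Rightarrow> nat) n. x (n - 1)"
  have "?R \<in> measurable \<mu> \<mu>"
    using measurable_seq_reindex[of "\<lambda>n. n - 1" r] assms(6) by (simp cong: measurable_cong_sets)
  then have "invariant_under \<mu> ?R"
    by (rule invariant_under_left_inverse[OF assms(7)]) (simp add: seq_shift_def)
  then show "directional_entropy (natext_measure \<mu> T) (action_power (natext_action \<mu> seq_shift T) u) v =
      ereal (real u) * directional_entropy (natext_measure \<mu> T) (natext_action \<mu> seq_shift T) v"
    by (intro directional_entropy_action_power[where R = ?R] assms)
      \<comment> \<open>The first call unfolds the shift only on sequences of the form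
        \<open>?R x\<close>, so that its commutation rule with the automaton still matches.\<close>
      (auto simp: seq_shift_def[of "\<lambda>n. _ (n - 1)"] seq_shift_cellular_automaton assms(4), auto simp: seq_shift_def)
qed

end
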